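(* Let $V$ be a simple vertex algebra over $\mathbb{C}$ of countable dimension. Then the linear map $\pi_2^V:V\otimes V\to V((z))$, $u\otimes v\mapsto Y(u,z)v$, is injective. In particular, every irreducible vertex algebra of countable dimension is $\pi_2$-injective (i.e. $\pi_2^V$ is injective).
   Context: All vector spaces and tensor products are over $\mathbb{C}$. A vertex algebra is a vector space $V$ with a vacuum vector $\mathbf{1}\in V$ and a linear map $Y(\cdot,z): V\to \mathrm{End}_{\mathbb{C}}(V)[[z,z^{-1}]]$, $v\mapsto Y(v,z)=\sum_{n\in\mathbb{Z}} v_n z^{-n-1}$, such that: for $u,v\in V$, $u_nv=0$ for $n$ sufficiently large; $Y(\mathbf{1},z)=\mathrm{Id}_V$; $Y(u,z)\mathbf{1}\in u+zV[[z]]$; and the Jacobi identity $$z_0^{-1}\delta\left(\tfrac{z_1-z_2}{z_0}\right)Y(u,z_1)Y(v,z_2)-z_0^{-1}\delta\left(\tfrac{z_2-z_1}{-z_0}\right)Y(v,z_2)Y(u,z_1)=z_2^{-1}\delta\left(\tfrac{z_1-z_0}{z_2}\right)Y(Y(u,z_0)v,z_2)$$ holds, where $\delta(z)=\sum_{n\in\mathbb{Z}}z^n$ and binomials are expanded in nonnegative integral powers of the second variable. No grading is assumed. Let $\mathcal{D}\in\mathrm{End}(V)$ be $\mathcal{D}(v)=v_{-2}\mathbf{1}$. $V$ is a module over itself via $Y$; a $V$-submodule is a subspace stable under all $u_n$ ($u\in V$, $n\in\mathbb{Z}$). $V$ is irreducible if it is an irreducible $V$-module. $V$ is simple if it contains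 no $\mathcal{D}$-stable $V$-submodule other than $0$ and $V$. *)

theory Defs
  imports
    "HOL-Computational_Algebra.Formal_Laurent_Series"
    "HOL-Library.Poly_Mapping"
    "HOL-Library.Product_Plus"
    "HOL-Library.Groups_Big_Fun"
    "HOL-Library.Countable_Set"
begin

section \<open>Complex vector spaces\<close>

class complex_vector = ab_group_add +
  fixes scaleC :: "complex \<Rightarrow> 'a \<Rightarrow> 'a" (infixr \<open>*\<^sub>C\<close> 75)
  assumes scaleC_add_right: "a *\<^sub>C (x + y) = a *\<^sub>C x + a *\<^sub>C y"
    and scaleC_add_left: "(a + b) *\<^sub>C x = a *\<^sub>C x + b *\<^sub>C x"
    and scaleC_scaleC: "a *\<^sub>C b *\<^sub>C x = (a * b) *\<^sub>C x"
    and scaleC_one: "1 *\<^sub>C x = x"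

interpretation complex_vector: vector_space "scaleC :: complex \<Rightarrow> 'a \<Rightarrow> 'a :: complex_vector"
  by unfold_locales (simp_all add: scaleC_add_right scaleC_add_left scaleC_scaleC scaleC_one)

abbreviation complex_linear :: "('a::complex_vector \<Rightarrow> 'b::complex_vector) \<Rightarrow> bool" where
  "complex_linear \<equiv> Vector_Spaces.linear scaleC scaleC"

lemma complex_linearI:
  assumes "\<And>x y. f (x + y) = f x + f y" and "\<And>c x. f (c *\<^sub>C x) = c *\<^sub>C f x"
  shows "complex_linear f"
  by unfold_locales (use assms in auto)

lemma complex_linear_add: "complex_linear f \<Longrightarrow> f (x + y) = f x + f y"
  and complex_linear_scale: "complex_linear f \<Longrightarrow> f (c *\<^sub>C x) = c *\<^sub>C f x"
  by (simp_all add: Vector_Spaces.linear.axioms module_hom.add module_hom.scale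
      Vector_Spaces.linear_iff_module_hom)

text \<open>Finite dimension is included.\<close>

definition countable_dimension :: "'a::complex_vector itself \<Rightarrow> bool" where
  "countable_dimension _ \<longleftrightarrow>
    (\<exists>B::'a set. countable B \<and> \<not> complex_vector.dependent B \<and> complex_vector.span B = UNIV)"

instantiation complex :: complex_vector
begin
definition scaleC_complex :: "complex \<Rightarrow> complex \<Rightarrow> complex" where
  [simp]: "scaleC_complex c x = c * x"
instance by standard (simp_all add: algebra_simps)
end

instantiation fls :: (complex_vector) complex_vector
begin
lift_definition scaleC_fls :: "complex \<Rightarrow> 'a fls \<Rightarrow> 'a fls" is "\<lambda>c f n. c *\<^sub>C f n"
  by (erule MOST_mono) simp
instance
  by standard (transfer; simp add: fun_eq_iff scaleC_add_right scaleC_add_left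
      scaleC_scaleC scaleC_one)+
end

lemma fls_scaleC_nth [simp]: "fls_nth (c *\<^sub>C f) n = c *\<^sub>C fls_nth f n"
  by transfer simp

instantiation poly_mapping :: (type, complex_vector) complex_vector
begin
lift_definition scaleC_poly_mapping :: "complex \<Rightarrow> ('a \<Rightarrow>\<^sub>0 'b) \<Rightarrow> ('a \<Rightarrow>\<^sub>0 'b)" is
  "\<lambda>c f k. c *\<^sub>C f k"
  by (erule rev_finite_subset) auto
instance
  by standard (transfer; simp add: fun_eq_iff scaleC_add_right scaleC_add_left
      scaleC_scaleC scaleC_one)+
end

lemma lookup_scaleC [simp]: "Poly_Mapping.lookup (c *\<^sub>C f) k = c *\<^sub>C Poly_Mapping.lookup f k"
  by transfer simp


section \<open>Tensor products\<close>

text \<open>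
  The tensor product is the free vector space on pairs modulo the span of the bilinearity relators.
\<close>

definition tensor_relators ::
  "(('a::complex_vector \<times> 'b::complex_vector) \<Rightarrow>\<^sub>0 complex) set" where
  "tensor_relators =
     {Poly_Mapping.single (u + u', v) 1 - Poly_Mapping.single (u, v) 1
        - Poly_Mapping.single (u', v) 1 | u u' v. True} \<union>
     {Poly_Mapping.single (u, v + v') 1 - Poly_Mapping.single (u, v) 1
        - Poly_Mapping.single (u, v') 1 | u v v'. True} \<union>
     {Poly_Mapping.single (c *\<^sub>C u, v) 1 - c *\<^sub>C Poly_Mapping.single (u, v) 1 | c u v. True} \<union>
     {Poly_Mapping.single (u, c *\<^sub>C v) 1 - c *\<^sub>C Poly_Mapping.single (u, v) 1 | c u v. True}"

definition tensor_rel ::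
  "(('a::complex_vector \<times> 'b::complex_vector) \<Rightarrow>\<^sub>0 complex) \<Rightarrow> (('a \<times> 'b) \<Rightarrow>\<^sub>0 complex) \<Rightarrow> bool" where
  "tensor_rel f g \<longleftrightarrow> f - g \<in> complex_vector.span tensor_relators"

lemma equivp_tensor_rel: "equivp tensor_rel"
proof (rule equivpI)
  show "reflp tensor_rel"
    by (simp add: reflp_def tensor_rel_def complex_vector.span_zero)
  show "symp tensor_rel"
    using complex_vector.span_neg by (fastforce simp: symp_def tensor_rel_def)
  show "transp tensor_rel"
    using complex_vector.span_add by (fastforce simp: transp_def tensor_rel_def)
qed

quotient_type (overloaded) ('a, 'b) tensor =
  "('a::complex_vector \<times> 'b::complex_vector) \<Rightarrow>\<^sub>0 complex" / tensor_rel
  by (rule equivp_tensor_rel)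

instantiation tensor :: (complex_vector, complex_vector) complex_vector
begin

lift_definition zero_tensor :: "('a, 'b) tensor" is 0 .

lift_definition plus_tensor :: "('a, 'b) tensor \<Rightarrow> ('a, 'b) tensor \<Rightarrow> ('a, 'b) tensor" is "(+)"
  unfolding tensor_rel_def by (subst add_diff_add) (rule complex_vector.span_add)

lift_definition uminus_tensor :: "('a, 'b) tensor \<Rightarrow> ('a, 'b) tensor" is uminus
  unfolding tensor_rel_def by (subst minus_diff_minus) (rule complex_vector.span_neg)

lift_definition minus_tensor :: "('a, 'b) tensor \<Rightarrow> ('a, 'b) tensor \<Rightarrow> ('a, 'b) tensor" is "(-)"
proof -
  fix f f' g g' :: "('a \<times> 'b) \<Rightarrow>\<^sub>0 complex"
  assume "tensor_rel f f'" "tensor_rel g g'"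
  moreover have "f - g - (f' - g') = (f - f') - (g - g')"
    by (simp add: algebra_simps)
  ultimately show "tensor_rel (f - g) (f' - g')"
    unfolding tensor_rel_def by (metis complex_vector.span_diff)
qed

lift_definition scaleC_tensor :: "complex \<Rightarrow> ('a, 'b) tensor \<Rightarrow> ('a, 'b) tensor" is scaleC
  unfolding tensor_rel_def
  by (subst complex_vector.scale_right_diff_distrib [symmetric]) (rule complex_vector.span_scale)

instance
  by standard
    (transfer; simp add: tensor_rel_def complex_vector.span_zero algebra_simps
      scaleC_add_right scaleC_add_left scaleC_scaleC scaleC_one)+

end

lift_definition pure_tensor :: "'a::complex_vector \<Rightarrow> 'b::complex_vector \<Rightarrow> ('a, 'b) tensor"
  (infixr \<open>\<otimes>\<^sub>C\<close> 70) is "\<lambda>u v. Poly_Mapping.single (u, v) 1" .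

definition free_lift ::
  "('a \<Rightarrow> 'b \<Rightarrow> 'c::complex_vector) \<Rightarrow> (('a \<times> 'b) \<Rightarrow>\<^sub>0 complex) \<Rightarrow> 'c" where
  "free_lift b f = (\<Sum>(u, v)\<in>Poly_Mapping.keys f. Poly_Mapping.lookup f (u, v) *\<^sub>C b u v)"

text \<open>
  The linear map on the tensor product induced by a map \<open>b\<close> of two arguments. It is independent of
  the representative only when \<open>b\<close> is bilinear; see \<open>tensor_lift_pure\<close> and \<open>complex_linear_tensor_lift\<close>.
\<close>

definition tensor_lift ::
  "('a::complex_vector \<Rightarrow> 'b::complex_vector \<Rightarrow> 'c::complex_vector) \<Rightarrow> ('a, 'b) tensor \<Rightarrow> 'c" where
  "tensor_lift b t = free_lift b (rep_tensor t)"

lemma free_lift_superset: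
  assumes "finite S" "Poly_Mapping.keys f \<subseteq> S"
  shows "free_lift b f = (\<Sum>(u, v)\<in>S. Poly_Mapping.lookup f (u, v) *\<^sub>C b u v)"
  unfolding free_lift_def using assms
  by (intro sum.mono_neutral_left) (auto simp: in_keys_iff)

lemma complex_linear_free_lift: "complex_linear (free_lift b)"
proof (rule complex_linearI)
  fix f g :: "('a \<times> 'b) \<Rightarrow>\<^sub>0 complex" and c :: complex
  let ?S = "Poly_Mapping.keys f \<union> Poly_Mapping.keys g"
  have "free_lift b (f + g) = (\<Sum>(u, v)\<in>?S. Poly_Mapping.lookup (f + g) (u, v) *\<^sub>C b u v)"
    by (intro free_lift_superset) (auto simp: Poly_Mapping.keys_add)
  also have "\<dots> = free_lift b f + free_lift b g"
    by (simp add: free_lift_superset[of ?S f] free_lift_superset[of ?S g] lookup_add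
        scaleC_add_left sum.distrib case_prod_unfold)
  finally show "free_lift b (f + g) = free_lift b f + free_lift b g" .
  have "free_lift b (c *\<^sub>C f) =
      (\<Sum>(u, v)\<in>Poly_Mapping.keys f. Poly_Mapping.lookup (c *\<^sub>C f) (u, v) *\<^sub>C b u v)"
    by (intro free_lift_superset) (auto simp: in_keys_iff)
  also have "\<dots> = c *\<^sub>C free_lift b f"
    by (simp add: free_lift_def complex_vector.scale_sum_right scaleC_scaleC case_prod_unfold)
  finally show "free_lift b (c *\<^sub>C f) = c *\<^sub>C free_lift b f" .
qed

lemma free_lift_single [simp]: "free_lift b (Poly_Mapping.single (u, v) c) = c *\<^sub>C b u v"
  by (cases "c = 0") (simp_all add: free_lift_def)

lemma free_lift_cong_tensor_rel:
  assumes b: "\<And>v. complex_linear (\<lambda>u. b u v)" "\<And>u. complex_linear (b u)"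
    and "tensor_rel f g"
  shows "free_lift b f = free_lift b g"
proof -
  note lin = complex_linear_free_lift[of b]
  interpret L: Vector_Spaces.linear scaleC scaleC "free_lift b" by (rule lin)
  have "h \<in> complex_vector.span tensor_relators \<Longrightarrow> free_lift b h = 0" for h
  proof (induction rule: complex_vector.span_induct)
    case base
    show ?case
      by (auto simp: complex_vector.subspace_def L.add L.scale)
  next
    case (step x)
    then show ?case
      unfolding tensor_relators_def
      by (auto simp: L.diff L.scale complex_linear_add[OF b(1)] complex_linear_add[OF b(2)]
          complex_linear_scale[OF b(1)] complex_linear_scale[OF b(2)] scaleC_one)
  qed
  with assms(3) have "free_lift b (f - g) = 0"
    by (simp add: tensor_rel_def)
  then show ?thesis by (simp add: L.diff)
qed

lemma tensor_lift_abs: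
  assumes "\<And>v. complex_linear (\<lambda>u. b u v)" "\<And>u. complex_linear (b u)"
  shows "tensor_lift b (abs_tensor f) = free_lift b f"
  unfolding tensor_lift_def
  by (rule free_lift_cong_tensor_rel[OF assms])
    (simp add: Quotient3_rep_abs[OF Quotient3_tensor] equivp_reflp[OF equivp_tensor_rel])

lemma tensor_lift_pure:
  assumes "\<And>v. complex_linear (\<lambda>u. b u v)" "\<And>u. complex_linear (b u)"
  shows "tensor_lift b (u \<otimes>\<^sub>C v) = b u v"
  by (simp add: pure_tensor.abs_eq tensor_lift_abs[OF assms] scaleC_one)

lemma complex_linear_tensor_lift:
  fixes b :: "'a::complex_vector \<Rightarrow> 'b::complex_vector \<Rightarrow> 'c::complex_vector"
  assumes "\<And>v. complex_linear (\<lambda>u. b u v)" "\<And>u. complex_linear (b u)"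
  shows "complex_linear (tensor_lift b)"
proof (rule complex_linearI)
  fix x y :: "('a, 'b) tensor" and c :: complex
  obtain f g where x: "x = abs_tensor f" and y: "y = abs_tensor g"
    by (metis Quotient3_abs_rep[OF Quotient3_tensor])
  show "tensor_lift b (x + y) = tensor_lift b x + tensor_lift b y"
    by (simp add: x y plus_tensor.abs_eq tensor_lift_abs[OF assms]
        complex_linear_add[OF complex_linear_free_lift])
  show "tensor_lift b (c *\<^sub>C x) = c *\<^sub>C tensor_lift b x"
    by (simp add: x scaleC_tensor.abs_eq tensor_lift_abs[OF assms]
        complex_linear_scale[OF complex_linear_free_lift])
qed


section \<open>Formal distributions in three variables\<close>

text \<open>\<open>A (a, b, c)\<close> is the coefficient of $z_0^a z_1^b z_2^c$.\<close>

type_synonym 'a fdist3 = "int \<times> int \<times> int \<Rightarrow> 'a"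

text \<open>
  Meaningful only if every coefficient is a finite sum (\<open>Sum_any\<close> of an infinitely supported family
  is 0). For the three products in the Jacobi identity this follows from the truncation axiom:
  see \<open>borcherds_identity\<close> below.
\<close>

definition fdist3_mult :: "complex fdist3 \<Rightarrow> 'v::complex_vector fdist3 \<Rightarrow> 'v fdist3" where
  "fdist3_mult d A e = Sum_any (\<lambda>e'. d e' *\<^sub>C A (e - e'))"

text \<open>The coefficient of $x^i y^j$ in $(x - y)^n$, expanded in nonnegative powers of $y$.\<close>

definition binomial_expansion :: "int \<Rightarrow> int \<Rightarrow> int \<Rightarrow> complex" where
  "binomial_expansion n i j =
     (if 0 \<le> j \<and> i + j = n then (-1) ^ nat j * (of_int n gchoose nat j) else 0)"

text \<open>
  The coefficient of $z^k x^i y^j$ in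
  $z^{-1}\delta((x-y)/(sz)) = \sum_n s^{-n} z^{-n-1} (x-y)^n$, where $s = 1$ or $s = -1$.
\<close>

definition delta_coeff :: "complex \<Rightarrow> int \<Rightarrow> int \<Rightarrow> int \<Rightarrow> complex" where
  "delta_coeff s k i j = s powi (k + 1) * binomial_expansion (- k - 1) i j"

lemma Sum_any_reindex_inj:
  assumes "inj g" "\<And>x. F x \<noteq> 0 \<Longrightarrow> x \<in> range g"
  shows "Sum_any F = Sum_any (\<lambda>i. F (g i))"
proof -
  have "{x. F x \<noteq> 0} = g ` {i. F (g i) \<noteq> 0}"
    using assms(2) by auto
  then show ?thesis
    unfolding Sum_any.expand_set using assms(1)
    by (simp add: sum.reindex inj_on_def)
qed

lemma fdist3_mult_delta_1:
  "fdist3_mult (\<lambda>(a, b, c). delta_coeff 1 a b c) (\<lambda>(a, b, c). if a = 0 then A b c else 0) (a, b, c) =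
    Sum_any (\<lambda>i. ((-1) ^ i * (of_int (- a - 1) gchoose i)) *\<^sub>C A (b + a + 1 + int i) (c - int i))"
proof -
  define g where "g = (\<lambda>i::nat. (a, - a - 1 - int i, int i))"
  show ?thesis
    unfolding fdist3_mult_def
  proof (subst Sum_any_reindex_inj[where g = g], goal_cases)
    case 1
    show ?case by (simp add: inj_def g_def)
  next
    case (2 x)
    obtain a' b' c' where "x = (a', b', c')" by (cases x)
    with 2 have "x = g (nat c')"
      by (auto simp: g_def delta_coeff_def binomial_expansion_def split: if_splits)
    then show ?case by simp
  next
    case 3
    show ?case
      by (rule Sum_any.cong) (simp add: g_def delta_coeff_def binomial_expansion_def algebra_simps)
  qed
qed

lemma fdist3_mult_delta_2:
  "fdist3_mult (\<lambda>(a, b, c). delta_coeff (-1) a c b) (\<lambda>(a, b, c). if a = 0 then A b c else 0) (a, b, c) =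
    Sum_any (\<lambda>i. ((-1) powi (a + 1) * (-1) ^ i * (of_int (- a - 1) gchoose i)) *\<^sub>C
      A (b - int i) (c + a + 1 + int i))"
proof -
  define g where "g = (\<lambda>i::nat. (a, int i, - a - 1 - int i))"
  show ?thesis
    unfolding fdist3_mult_def
  proof (subst Sum_any_reindex_inj[where g = g], goal_cases)
    case 1
    show ?case by (simp add: inj_def g_def)
  next
    case (2 x)
    obtain a' b' c' where "x = (a', b', c')" by (cases x)
    with 2 have "x = g (nat b')"
      by (auto simp: g_def delta_coeff_def binomial_expansion_def split: if_splits)
    then show ?case by simp
  next
    case 3
    show ?case
      by (rule Sum_any.cong) (simp add: g_def delta_coeff_def binomial_expansion_def algebra_simps)
  qed
qed

lemma fdist3_mult_delta_3:
  "fdist3_mult (\<lambda>(a, b, c). delta_coeff 1 c b a) (\<lambda>(a, b, c). if b = 0 then A a c else 0) (a, b, c) =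
    Sum_any (\<lambda>i. ((-1) ^ i * (of_int (b + int i) gchoose i)) *\<^sub>C A (a - int i) (c + b + 1 + int i))"
proof -
  define g where "g = (\<lambda>i::nat. (int i, b, - b - int i - 1))"
  show ?thesis
    unfolding fdist3_mult_def
  proof (subst Sum_any_reindex_inj[where g = g], goal_cases)
    case 1
    show ?case by (simp add: inj_def g_def)
  next
    case (2 x)
    obtain a' b' c' where "x = (a', b', c')" by (cases x)
    with 2 have "x = g (nat a')"
      by (auto simp: g_def delta_coeff_def binomial_expansion_def split: if_splits)
    then show ?case by simp
  next
    case 3
    show ?case
      by (rule Sum_any.cong) (simp add: g_def delta_coeff_def binomial_expansion_def algebra_simps)
  qed
qed


section \<open>Vertex algebras\<close>

text \<open>\<open>Y u n v\<close> is the mode $u_n v$, that is, the coefficient of $z^{-n-1}$ in $Y(u,z)v$.\<close>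

locale vertex_algebra =
  fixes vac :: "'v::complex_vector"
    and Y :: "'v \<Rightarrow> int \<Rightarrow> 'v \<Rightarrow> 'v"
  assumes linear_left: "complex_linear (\<lambda>u. Y u n v)"
    and linear_right: "complex_linear (Y u n)"
    and truncation: "\<exists>N. \<forall>n\<ge>N. Y u n v = 0"
    and vacuum: "Y vac n v = (if n = -1 then v else 0)"
    and creation: "n \<ge> 0 \<Longrightarrow> Y u n vac = 0" "Y u (-1) vac = u"
    and jacobi:
      "fdist3_mult (\<lambda>(a, b, c). delta_coeff 1 a b c)
         (\<lambda>(a, b, c). if a = 0 then Y u (-b-1) (Y v (-c-1) w) else 0) e
       - fdist3_mult (\<lambda>(a, b, c). delta_coeff (-1) a c b)
         (\<lambda>(a, b, c). if a = 0 then Y v (-c-1) (Y u (-b-1) w) else 0) e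
       = fdist3_mult (\<lambda>(a, b, c). delta_coeff 1 c b a)
         (\<lambda>(a, b, c). if b = 0 then Y (Y u (-a-1) v) (-c-1) w else 0) e"

definition vertex_D :: "'v::complex_vector \<Rightarrow> ('v \<Rightarrow> int \<Rightarrow> 'v \<Rightarrow> 'v) \<Rightarrow> 'v \<Rightarrow> 'v" where
  "vertex_D vac Y v = Y v (-2) vac"

definition vertex_submodule :: "('v::complex_vector \<Rightarrow> int \<Rightarrow> 'v \<Rightarrow> 'v) \<Rightarrow> 'v set \<Rightarrow> bool" where
  "vertex_submodule Y W \<longleftrightarrow> complex_vector.subspace W \<and> (\<forall>u n. \<forall>w\<in>W. Y u n w \<in> W)"

text \<open>Irreducible modules are nonzero by convention.\<close>

definition irreducible_vertex_algebra :: "('v::complex_vector \<Rightarrow> int \<Rightarrow> 'v \<Rightarrow> 'v) \<Rightarrow> bool" where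
  "irreducible_vertex_algebra Y \<longleftrightarrow>
     (UNIV :: 'v set) \<noteq> {0} \<and> (\<forall>W. vertex_submodule Y W \<longrightarrow> W = {0} \<or> W = UNIV)"

definition simple_vertex_algebra ::
  "'v::complex_vector \<Rightarrow> ('v \<Rightarrow> int \<Rightarrow> 'v \<Rightarrow> 'v) \<Rightarrow> bool" where
  "simple_vertex_algebra vac Y \<longleftrightarrow>
     (\<forall>W. vertex_submodule Y W \<and> vertex_D vac Y ` W \<subseteq> W \<longrightarrow> W = {0} \<or> W = UNIV)"

text \<open>$Y(u,z)v$ as an element of $V((z))$.\<close>

definition vertex_series :: "('v::complex_vector \<Rightarrow> int \<Rightarrow> 'v \<Rightarrow> 'v) \<Rightarrow> 'v \<Rightarrow> 'v \<Rightarrow> 'v fls" where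
  "vertex_series Y u v = Abs_fls (\<lambda>k. Y u (-k-1) v)"

definition pi2 :: "('v::complex_vector \<Rightarrow> int \<Rightarrow> 'v \<Rightarrow> 'v) \<Rightarrow> ('v, 'v) tensor \<Rightarrow> 'v fls" where
  "pi2 Y = tensor_lift (vertex_series Y)"

definition pi2_injective :: "('v::complex_vector \<Rightarrow> int \<Rightarrow> 'v \<Rightarrow> 'v) \<Rightarrow> bool" where
  "pi2_injective Y \<longleftrightarrow> inj (pi2 Y)"

context vertex_algebra
begin

lemma finite_modes: "finite {i. Y u (n + int i) v \<noteq> 0}"
proof -
  obtain N where N: "Y u n v = 0" if "n \<ge> N" for n
    using truncation[of u v] by blast
  have "{i. Y u (n + int i) v \<noteq> 0} \<subseteq> {..nat (N - n)}"
  proof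
    fix i assume "i \<in> {i. Y u (n + int i) v \<noteq> 0}"
    then have "\<not> n + int i \<ge> N" using N by blast
    then show "i \<in> {..nat (N - n)}" by simp
  qed
  then show ?thesis by (rule finite_subset) simp
qed

lemma gchoose_reflect: "(-1) ^ i * (of_int (int i - m - 1) gchoose i) = (of_int m gchoose i :: complex)"
  using gbinomial_negated_upper[of "of_int m :: complex" i] by (simp add: algebra_simps)

text \<open>The Jacobi identity in components; all three sums are finite by \<open>finite_modes\<close>.\<close>

lemma borcherds_identity:
  "Sum_any (\<lambda>i. ((-1) ^ i * (of_int l gchoose i)) *\<^sub>C Y u (m + l - int i) (Y v (n + int i) w))
   - Sum_any (\<lambda>i. ((-1) powi l * (-1) ^ i * (of_int l gchoose i)) *\<^sub>C
       Y v (n + l - int i) (Y u (m + int i) w))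
   = Sum_any (\<lambda>i. (of_int m gchoose i) *\<^sub>C Y (Y u (l + int i) v) (m + n - int i) w)"
proof -
  have sign: "(-1 :: complex) powi (- l) = (-1) powi l"
    by (cases "even l") simp_all
  show ?thesis
    using jacobi[of u v w "(- l - 1, - m - 1, - n - 1)"]
    unfolding fdist3_mult_delta_1[where A = "\<lambda>b c. Y u (-b-1) (Y v (-c-1) w)"]
      fdist3_mult_delta_2[where A = "\<lambda>b c. Y v (-c-1) (Y u (-b-1) w)"]
      fdist3_mult_delta_3[where A = "\<lambda>a c. Y (Y u (-a-1) v) (-c-1) w"]
    by (simp add: algebra_simps sign flip: gchoose_reflect[of _ m])
qed

lemma vertex_series_nth [simp]: "fls_nth (vertex_series Y u v) k = Y u (-k-1) v"
proof -
  obtain N where N: "Y u n v = 0" if "n \<ge> N" for n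
    using truncation[of u v] by blast
  have "\<forall>k < -N. Y u (-k-1) v = 0" by (auto intro: N)
  then show ?thesis
    unfolding vertex_series_def by (intro nth_Abs_fls_ex_lower_bound) blast
qed

lemma complex_linear_vertex_series:
  "complex_linear (\<lambda>u. vertex_series Y u v)" "complex_linear (vertex_series Y u)"
  by (auto intro!: complex_linearI fls_eqI
      simp: complex_linear_add[OF linear_left] complex_linear_add[OF linear_right]
        complex_linear_scale[OF linear_left] complex_linear_scale[OF linear_right])

lemma complex_linear_pi2: "complex_linear (pi2 Y)"
  unfolding pi2_def by (intro complex_linear_tensor_lift complex_linear_vertex_series)

lemma pi2_pure: "pi2 Y (u \<otimes>\<^sub>C v) = vertex_series Y u v"
  unfolding pi2_def by (intro tensor_lift_pure complex_linear_vertex_series)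

end

end

theory Submission
  imports Defs "HOL-Computational_Algebra.Fundamental_Theorem_Algebra"
    "HOL-Analysis.Continuum_Not_Denumerable"
begin

text \<open>
  Let \<open>\<Sum> Y(u, z) w\<^sub>u = 0\<close>, the sum running over finitely many linearly independent \<open>u\<close>. For fixed
  \<open>u\<close>'s, weak commutativity and the commutator of \<open>\<D>\<close> with \<open>Y(u, z)\<close> show that the solutions
  \<open>(w\<^sub>u)\<close> are stable under all modes and under \<open>\<D>\<close>. If, inductively, a solution with
  \<open>w\<^sub>x = 0\<close> vanishes and there is a nonzero solution, then by simplicity the solutions form the
  graph of a tuple of endomorphisms \<open>\<phi>\<^sub>u\<close> (with \<open>w\<^sub>u = \<phi>\<^sub>u w\<^sub>x\<close>) commuting with all
  modes and \<open>\<D>\<close>. As \<open>V\<close> has countable dimension over the uncountable algebraically closed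
  field of complex numbers, Schur's lemma makes each of them a scalar, and the solution with
  \<open>w\<^sub>x = \<one>\<close> yields a linear relation among the \<open>u\<close>'s.
\<close>

section \<open>The spectrum of an operator on a space of countable dimension\<close>

interpretation complex_vector_pair: vector_space_pair
  "scaleC :: complex \<Rightarrow> 'a \<Rightarrow> 'a :: complex_vector"
  "scaleC :: complex \<Rightarrow> 'b \<Rightarrow> 'b :: complex_vector"
  by unfold_locales

text \<open>Horner's rule for the vector \<open>p(f) x\<close>, which makes \<open>V\<close> a
  module over the polynomial ring.\<close>

definition poly_op :: "('a::complex_vector \<Rightarrow> 'a) \<Rightarrow> complex poly \<Rightarrow> 'a \<Rightarrow> 'a" where
  "poly_op f p x = fold_coeffs (\<lambda>a y. a *\<^sub>C x + f y) p 0"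

lemma poly_op_0 [simp]: "poly_op f 0 x = 0"
  by (simp add: poly_op_def)

context
  fixes f :: "'a::complex_vector \<Rightarrow> 'a"
  assumes lin: "complex_linear f"
begin

lemma poly_op_pCons [simp]: "poly_op f (pCons a p) x = a *\<^sub>C x + f (poly_op f p x)"
  by (cases "a = 0 \<and> p = 0")
    (auto simp: poly_op_def complex_vector_pair.linear_0[OF lin])

lemma poly_op_add: "poly_op f (p + q) x = poly_op f p x + poly_op f q x"
  by (induction p q rule: poly_induct2)
    (simp_all add: scaleC_add_left complex_linear_add[OF lin] algebra_simps)

lemma poly_op_smult: "poly_op f (smult c p) x = c *\<^sub>C poly_op f p x"
  by (induction p) (simp_all add: scaleC_add_right scaleC_scaleC complex_linear_scale[OF lin])

lemma poly_op_sum: "poly_op f (\<Sum>i\<in>I. p i) x = (\<Sum>i\<in>I. poly_op f (p i) x)"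
  by (induction I rule: infinite_finite_induct) (simp_all add: poly_op_add)

lemma poly_op_mult: "poly_op f (p * q) x = poly_op f p (poly_op f q x)"
  by (induction p) (simp_all add: poly_op_add poly_op_smult)

lemma complex_linear_poly_op: "complex_linear (poly_op f p)"
proof (rule complex_linearI)
  show "poly_op f p (x + y) = poly_op f p x + poly_op f p y" for x y
    by (induction p) (simp_all add: scaleC_add_right complex_linear_add[OF lin] algebra_simps)
  show "poly_op f p (c *\<^sub>C x) = c *\<^sub>C poly_op f p x" for c x
    by (induction p) (simp_all add: scaleC_add_right scaleC_scaleC complex_linear_scale[OF lin]
        mult.commute)
qed

text \<open>Over the complex numbers \<open>p\<close> splits into linear factors, and each factor
  \<open>f - c\<close> is injective because \<open>f\<close> has no eigenvector.\<close>

lemma poly_op_eq_0_imp: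
  assumes "\<And>c x. f x = c *\<^sub>C x \<Longrightarrow> x = 0" and "p \<noteq> 0" "poly_op f p x = 0"
  shows "x = 0"
  using assms(2,3)
proof (induction "degree p" arbitrary: p)
  case 0
  then obtain a where "p = [:a:]" by (metis degree_eq_zeroE)
  with 0 show ?case by (simp add: complex_vector_pair.linear_0[OF lin])
next
  case (Suc n)
  then have "\<not> constant (poly p)"
    by (simp add: constant_degree)
  then obtain c where "poly p c = 0"
    using fundamental_theorem_of_algebra by blast
  then obtain q where q: "p = [:-c, 1:] * q"
    by (metis poly_eq_0_iff_dvd dvdE)
  with Suc.prems have "q \<noteq> 0" by auto
  with Suc.hyps(2) have "degree q = n"
    by (simp add: q degree_mult_eq del: mult_pCons_left)
  moreover have "poly_op f [:-c, 1:] (poly_op f q x) = 0"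
    using Suc.prems(2) unfolding q poly_op_mult .
  then have "f (poly_op f q x) = c *\<^sub>C poly_op f q x"
    by (simp add: complex_vector_pair.linear_0[OF lin] complex_linear_add[OF lin])
  then have "poly_op f q x = 0" by (rule assms(1))
  ultimately show ?case using Suc.hyps(1) \<open>q \<noteq> 0\<close> by blast
qed

text \<open>
  In terms of \<open>f\<close>, the vector \<open>g c\<close> is \<open>(f - c)\<inverse> v\<close>; the relation is cleared of denominators.
\<close>

lemma resolvent_coefficients_eq_0:
  assumes inj: "\<And>c x. f x = c *\<^sub>C x \<Longrightarrow> x = 0" and "v \<noteq> 0"
    and g: "\<And>c. f (g c) - c *\<^sub>C g c = v"
    and "finite C" "(\<Sum>c\<in>C. a c *\<^sub>C g c) = 0" "d \<in> C"
  shows "a d = 0"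
proof -
  \<comment> \<open>With \<open>P\<close> the product of all \<open>X - e\<close>,
    \<open>r c\<close> is the cofactor of \<open>X - c\<close>, so \<open>P(f)\<close> sends
    \<open>g c\<close> to \<open>r c (f) v\<close>. Applying \<open>P(f)\<close> to the relation
    gives \<open>p(f) v = 0\<close>.\<close>
  define r where "r c = (\<Prod>e\<in>C - {c}. [:-e, 1:])" for c
  define p where "p = (\<Sum>c\<in>C. smult (a c) (r c))"
  have prod: "(\<Prod>e\<in>C. [:-e, 1:]) = r c * [:-c, 1:]" if "c \<in> C" for c
    using prod.remove[OF \<open>finite C\<close> that, of "\<lambda>e. [:-e, 1:]"] by (simp add: r_def mult.commute)
  have "poly_op f [:-c, 1:] (g c) = v" for c
    using g[of c] by (simp add: complex_vector_pair.linear_0[OF lin] algebra_simps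
        complex_linear_add[OF lin])
  then have "poly_op f (\<Prod>e\<in>C. [:-e, 1:]) (g c) = poly_op f (r c) v" if "c \<in> C" for c
    unfolding prod[OF that] poly_op_mult by simp
  then have "poly_op f p v = (\<Sum>c\<in>C. a c *\<^sub>C poly_op f (\<Prod>e\<in>C. [:-e, 1:]) (g c))"
    by (simp add: p_def poly_op_sum poly_op_smult)
  also have "\<dots> = poly_op f (\<Prod>e\<in>C. [:-e, 1:]) (\<Sum>c\<in>C. a c *\<^sub>C g c)"
    by (simp add: complex_vector_pair.linear_sum[OF complex_linear_poly_op]
        complex_linear_scale[OF complex_linear_poly_op])
  also have "\<dots> = 0"
    by (simp add: assms(5) complex_vector_pair.linear_0[OF complex_linear_poly_op])
  finally have "p = 0"
    using poly_op_eq_0_imp[of p v] inj \<open>v \<noteq> 0\<close> by blast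
  have "0 = (\<Sum>c\<in>C. a c * poly (r c) d)"
    using arg_cong[OF \<open>p = 0\<close>, of "\<lambda>p. poly p d"] by (simp add: p_def poly_sum)
  \<comment> \<open>For \<open>c \<noteq> d\<close> the factor \<open>X - d\<close> occurs in
    \<open>r c\<close>, so evaluation at \<open>d\<close> isolates \<open>a d\<close>; the value of
    \<open>r d\<close> at \<open>d\<close> is a product of nonzero differences.\<close>
  also have "\<dots> = (\<Sum>c\<in>C. if c = d then a d * poly (r d) d else 0)"
    using \<open>finite C\<close> \<open>d \<in> C\<close> by (intro sum.cong) (auto simp: r_def poly_prod)
  also have "\<dots> = a d * poly (r d) d"
    using \<open>finite C\<close> \<open>d \<in> C\<close> by simp
  finally show ?thesis
    using \<open>finite C\<close> by (auto simp: r_def poly_prod)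
qed

text \<open>Otherwise the vectors \<open>(f - c)\<inverse> v\<close> would form an uncountable
  independent family.\<close>

lemma ex_not_bij_diff_scaleC:
  assumes "countable_dimension TYPE('a)" and "v \<noteq> (0::'a)"
  shows "\<exists>c. \<not> bij (\<lambda>x. f x - c *\<^sub>C x)"
proof (rule ccontr)
  assume "\<nexists>c. \<not> bij (\<lambda>x. f x - c *\<^sub>C x)"
  then have bij: "bij (\<lambda>x. f x - c *\<^sub>C x)" for c by blast
  have inj: "x = 0" if "f x = c *\<^sub>C x" for c x
    using injD[OF bij_is_inj[OF bij[of c]], of x 0] that
    by (simp add: complex_vector_pair.linear_0[OF lin])
  have "\<exists>y. f y - c *\<^sub>C y = v" for c
    using surjD[OF bij_is_surj[OF bij[of c]], of v] by (simp add: eq_commute)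
  then have "\<forall>c. \<exists>y. f y - c *\<^sub>C y = v" by blast
  from choice[OF this] obtain g where g: "f (g c) - c *\<^sub>C g c = v" for c by blast
  have "inj g"
  proof (rule injI)
    fix c d assume "g c = g d"
    with g[of c] g[of d] have "f (g c) - c *\<^sub>C g c = f (g c) - d *\<^sub>C g c" by simp
    then have "c *\<^sub>C g c = d *\<^sub>C g c" by simp
    moreover have "g c \<noteq> 0"
      using g[of c] \<open>v \<noteq> 0\<close> by (auto simp: complex_vector_pair.linear_0[OF lin])
    ultimately show "c = d" by simp
  qed
  have coeff: "a d = 0"
    if "finite C" "(\<Sum>c\<in>C. a c *\<^sub>C g c) = 0" "d \<in> C" for a d C
    using inj \<open>v \<noteq> 0\<close> g that by (rule resolvent_coefficients_eq_0)
  have indep: "\<not> complex_vector.dependent (g ` C)" if "finite C" for C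
    unfolding complex_vector.dependent_finite[OF finite_imageI[OF that]]
    using coeff[OF that, of "\<lambda>c. a (g c)" for a] inj_on_subset[OF \<open>inj g\<close>]
    by (auto simp: sum.reindex)
  obtain B :: "'a set" where B: "countable B" "complex_vector.span B = UNIV"
    using assms(1) by (auto simp: countable_dimension_def)
  \<comment> \<open>Every \<open>g c\<close> lies in the span of some finite
    \<open>T \<subseteq> B\<close>. There are countably many such \<open>T\<close>, and by
    independence each span contains at most \<open>card T\<close> of the \<open>g c\<close>, so the
    complex numbers would be countable.\<close>
  define F where "F = {T. finite T \<and> T \<subseteq> B}"
  have "\<exists>T\<in>F. g c \<in> complex_vector.span T" for c
  proof -
    have "g c \<in> complex_vector.span B" by (simp add: B)
    then obtain T a where "finite T" "T \<subseteq> B" "g c = (\<Sum>b\<in>T. a b *\<^sub>C b)"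
      unfolding complex_vector.span_explicit by auto
    then have "T \<in> F" "g c \<in> complex_vector.span T"
      by (simp_all add: F_def complex_vector.span_sum complex_vector.span_scale
          complex_vector.span_base)
    then show ?thesis by blast
  qed
  then have "(UNIV :: complex set) \<subseteq> (\<Union>T\<in>F. {c. g c \<in> complex_vector.span T})" by blast
  moreover have "countable F"
    unfolding F_def using countable_Collect_finite_subset[OF B(1)] by simp
  moreover have "finite {c. g c \<in> complex_vector.span T}" if "T \<in> F" for T
  proof (rule ccontr)
    assume "infinite {c. g c \<in> complex_vector.span T}"
    then obtain C where C: "C \<subseteq> {c. g c \<in> complex_vector.span T}" "finite C" "card C = Suc (card T)"
      using infinite_arbitrarily_large by blast
    have "card (g ` C) \<le> card T"
      using that C(1) complex_vector.independent_span_bound[OF _ indep[OF \<open>finite C\<close>], of T]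
      by (auto simp: F_def)
    then show False
      using C card_image[of g C] inj_on_subset[OF \<open>inj g\<close>] by simp
  qed
  ultimately have "countable (UNIV :: complex set)"
    by (meson countable_UN countable_finite countable_subset)
  then show False using uncountable_UNIV_complex by blast
qed

end

section \<open>Relations among fields of a vertex algebra\<close>

context vertex_algebra
begin

text \<open>Borcherds identity with \<open>l = n\<close>, \<open>m = 0\<close>, third index
  \<open>-2\<close>, applied to the vacuum: creation leaves two terms of the first sum and none of
  the second, and \<open>m = 0\<close> leaves one on the right.\<close>

lemma vertex_D_commutator:
  "Y u n (vertex_D vac Y v) = vertex_D vac Y (Y u n v) + of_int n *\<^sub>C Y u (n - 1) v"
proof -
  let ?c = "\<lambda>i. ((-1) ^ i * (of_int n gchoose i)) *\<^sub>C Y u (n - int i) (Y v (-2 + int i) vac)"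
  have "?c i = 0" if "i \<notin> {0, 1}" for i
    using that creation(1)[of "-2 + int i" v]
    by (simp add: complex_vector_pair.linear_0[OF linear_right])
  then have "{i. ?c i \<noteq> 0} \<subseteq> {0, 1}" by blast
  then have "Sum_any ?c = sum ?c {0, 1}"
    by (intro Sum_any.expand_superset) simp_all
  also have "\<dots> = Y u n (vertex_D vac Y v) - of_int n *\<^sub>C Y u (n - 1) v"
    by (simp add: vertex_D_def creation)
  moreover have "Sum_any (\<lambda>i. (of_int 0 gchoose i) *\<^sub>C Y (Y u (n + int i) v) (0 + -2 - int i) vac)
      = (\<Sum>i\<in>{0}. (of_int 0 gchoose i) *\<^sub>C Y (Y u (n + int i) v) (0 + -2 - int i) vac)"
    by (rule Sum_any.expand_superset) (auto simp: gbinomial_0_left split: if_splits)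
  moreover have "\<dots> = vertex_D vac Y (Y u n v)"
    by (simp add: vertex_D_def)
  ultimately show ?thesis
    using borcherds_identity[of n u 0 v "-2" vac]
    by (simp add: creation complex_vector_pair.linear_0[OF linear_right] algebra_simps)
qed

text \<open>A tuple indexed by \<open>S\<close> is encoded as a total function; its values outside
  \<open>S\<close> are arbitrary, so tuples are compared only on \<open>S\<close>.\<close>

definition field_relations :: "'v set \<Rightarrow> ('v \<Rightarrow> 'v) set" where
  "field_relations S = {w. \<forall>n. (\<Sum>u\<in>S. Y u n (w u)) = 0}"

text \<open>Commuting \<open>\<D>\<close> past mode \<open>n\<close> costs \<open>n\<close> times
  the relation at \<open>n - 1\<close>, which is zero as well.\<close>

lemma field_relations_vertex_D:
  assumes "w \<in> field_relations S"
  shows "(\<lambda>u. vertex_D vac Y (w u)) \<in> field_relations S"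
proof -
  have "(\<Sum>u\<in>S. vertex_D vac Y (Y u n (w u))) = 0" for n
    using assms complex_vector_pair.linear_sum[OF linear_left[of "-2" vac], of "\<lambda>u. Y u n (w u)" S]
      complex_vector_pair.linear_0[OF linear_left[of "-2" vac]]
    by (simp add: field_relations_def vertex_D_def)
  then show ?thesis
    using assms
    by (simp add: field_relations_def vertex_D_commutator sum.distrib
        flip: complex_vector.scale_sum_right)
qed

lemma truncation_uniform:
  assumes "finite S"
  shows "\<exists>N. \<forall>u\<in>S. \<forall>n\<ge>N. Y (f u) n (g u) = 0"
proof -
  have "eventually (\<lambda>n. \<forall>u\<in>S. Y (f u) n (g u) = 0) at_top"
    using assms truncation by (intro eventually_ball_finite) (auto simp: eventually_at_top_linorder)
  then show ?thesis by (auto simp: eventually_at_top_linorder)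
qed

text \<open>
  By weak commutativity the sums \<open>T p q\<close> below, as a series in two variables, are annihilated by
  \<open>(z\<^sub>1 - z\<^sub>2)^l\<close>. Since \<open>T p q = 0\<close> for large \<open>q\<close>, the relation is solved by
  descending induction on \<open>q\<close>.
\<close>

lemma field_relations_mode:
  assumes w: "w \<in> field_relations S" and "finite S"
  shows "(\<lambda>u. Y a q (w u)) \<in> field_relations S"
proof -
  define T where "T p q = (\<Sum>u\<in>S. Y u p (Y a q (w u)))" for p q
  obtain N where N: "\<And>u n. u \<in> S \<Longrightarrow> n \<ge> N \<Longrightarrow> Y u n a = 0"
    using truncation_uniform[OF \<open>finite S\<close>, of "\<lambda>u. u" "\<lambda>_. a"] by blast
  \<comment> \<open>As \<open>int l \<ge> N\<close>, the right side of the Borcherds identity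
    vanishes for all \<open>u\<close> in \<open>S\<close>: weak commutativity with a common
    exponent.\<close>
  define l where "l = nat N"
  obtain Q where Q: "\<And>u n. u \<in> S \<Longrightarrow> n \<ge> Q \<Longrightarrow> Y a n (w u) = 0"
    using truncation_uniform[OF \<open>finite S\<close>, of "\<lambda>_. a" w] by blast
  have expand: "Sum_any (\<lambda>i. (c i * (of_int (int l) gchoose i)) *\<^sub>C A i)
      = (\<Sum>i\<le>l. (c i * (of_int (int l) gchoose i)) *\<^sub>C A i)" for c and A :: "nat \<Rightarrow> 'v"
  proof (rule Sum_any.expand_superset)
    have "of_int (int l) gchoose i = (0 :: complex)" if "\<not> i \<le> l" for i
      using that by (simp add: binomial_eq_0 flip: binomial_gbinomial)
    then show "{i. (c i * (of_int (int l) gchoose i)) *\<^sub>C A i \<noteq> 0} \<subseteq> {..l}"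
      by (metis (mono_tags, lifting) atMost_iff complex_vector.scale_zero_left mem_Collect_eq
          mult_zero_right subsetI)
  qed simp
  have rec: "(\<Sum>i\<le>l. ((-1) ^ i * (of_int (int l) gchoose i)) *\<^sub>C T (m + int l - int i) (n + int i)) = 0"
    for m n
  proof -
    have "(\<Sum>i\<le>l. ((-1) ^ i * (of_int (int l) gchoose i)) *\<^sub>C Y u (m + int l - int i) (Y a (n + int i) (w u)))
      = (\<Sum>i\<le>l. ((-1) powi int l * (-1) ^ i * (of_int (int l) gchoose i)) *\<^sub>C
           Y a (n + int l - int i) (Y u (m + int i) (w u)))" if "u \<in> S" for u
    proof -
      have "Y u (int l + int i) a = 0" for i
        by (rule N[OF that]) (simp add: l_def)
      then show ?thesis
        using borcherds_identity[of "int l" u m a n "w u"]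
        unfolding expand by (simp add: complex_vector_pair.linear_0[OF linear_left])
    qed
    \<comment> \<open>Summing over \<open>u\<close> and pulling the modes of \<open>a\<close> out of
      the sum exposes the given relation on the right.\<close>
    then have "(\<Sum>i\<le>l. ((-1) ^ i * (of_int (int l) gchoose i)) *\<^sub>C T (m + int l - int i) (n + int i))
      = (\<Sum>i\<le>l. ((-1) powi int l * (-1) ^ i * (of_int (int l) gchoose i)) *\<^sub>C
           Y a (n + int l - int i) (\<Sum>u\<in>S. Y u (m + int i) (w u)))"
      unfolding T_def complex_vector_pair.linear_sum[OF linear_right] complex_vector.scale_sum_right
      by (subst (1 2) sum.swap) (rule sum.cong, simp_all)
    also have "\<dots> = 0"
      using w by (simp add: field_relations_def complex_vector_pair.linear_0[OF linear_right])
    finally show ?thesis .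
  qed
  have T: "\<forall>p. T p (Q - int k) = 0" for k
  proof (induction k rule: less_induct)
    case (less k)
    have zero: "T p q = 0" if "q > Q - int k" for p q
    proof (cases "q \<ge> Q")
      case True
      then show ?thesis by (simp add: T_def Q complex_vector_pair.linear_0[OF linear_right])
    next
      case False
      with that less[of "nat (Q - q)"] show ?thesis by simp
    qed
    show ?case
    proof
      fix p
      \<comment> \<open>Terms with \<open>i > 0\<close> have larger second index and vanish by
        induction; the term \<open>i = 0\<close> has coefficient 1.\<close>
      have "0 = (\<Sum>i\<le>l. ((-1) ^ i * (of_int (int l) gchoose i)) *\<^sub>C T (p - int i) (Q - int k + int i))"
        using rec[of "p - int l" "Q - int k"] by simp
      also have "\<dots> = (\<Sum>i\<in>{0}. ((-1) ^ i * (of_int (int l) gchoose i)) *\<^sub>C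
          T (p - int i) (Q - int k + int i))"
        by (rule sum.mono_neutral_right) (auto simp: zero)
      finally show "T p (Q - int k) = 0" by simp
    qed
  qed
  have "T p q = 0" for p
  proof (cases "q \<ge> Q")
    case True
    then show ?thesis by (simp add: T_def Q complex_vector_pair.linear_0[OF linear_right])
  next
    case False
    with T[of "nat (Q - q)"] show ?thesis by simp
  qed
  then show ?thesis by (simp add: field_relations_def T_def)
qed

lemma field_relations_add:
  "w \<in> field_relations S \<Longrightarrow> w' \<in> field_relations S \<Longrightarrow> (\<lambda>u. w u + w' u) \<in> field_relations S"
  by (simp add: field_relations_def complex_linear_add[OF linear_right] sum.distrib)

lemma field_relations_scale:
  "w \<in> field_relations S \<Longrightarrow> (\<lambda>u. c *\<^sub>C w u) \<in> field_relations S"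
  by (simp add: field_relations_def complex_linear_scale[OF linear_right]
      flip: complex_vector.scale_sum_right)

section \<open>Schur's lemma and independence of fields\<close>

lemma schur_countable_dimension:
  assumes simple: "simple_vertex_algebra vac Y" and "countable_dimension TYPE('v)"
    and f: "complex_linear f" "\<And>a n v. f (Y a n v) = Y a n (f v)"
      "\<And>v. f (vertex_D vac Y v) = vertex_D vac Y (f v)"
  shows "\<exists>c. \<forall>v. f v = c *\<^sub>C v"
proof (cases "\<exists>v::'v. v \<noteq> 0")
  case False
  then show ?thesis by metis
next
  case True
  then obtain c where c: "\<not> bij (\<lambda>x. f x - c *\<^sub>C x)"
    using ex_not_bij_diff_scaleC[OF f(1) assms(2)] by blast
  \<comment> \<open>The kernel and image of \<open>h\<close> are \<open>\<D>\<close>-stable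
    submodules, hence trivial by simplicity; as \<open>h\<close> is not bijective, it must be
    zero.\<close>
  define h where "h x = f x - c *\<^sub>C x" for x
  have h: "complex_linear h"
    by (rule complex_linearI)
      (simp_all add: h_def complex_linear_add[OF f(1)] complex_linear_scale[OF f(1)]
        complex_vector.scale_right_diff_distrib scaleC_add_right scaleC_scaleC mult.commute)
  have hY: "h (Y a n v) = Y a n (h v)" for a n v
    by (simp add: h_def f(2) complex_vector_pair.linear_diff[OF linear_right]
        complex_linear_scale[OF linear_right])
  have hD: "h (vertex_D vac Y v) = vertex_D vac Y (h v)" for v
    by (simp add: h_def f(3)[unfolded vertex_D_def] vertex_D_def complex_vector_pair.linear_diff[OF linear_left]
        complex_linear_scale[OF linear_left])
  have D0: "vertex_D vac Y 0 = 0"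
    by (simp add: vertex_D_def complex_vector_pair.linear_0[OF linear_left])
  have "vertex_submodule Y {v. h v = 0}"
    by (auto simp: vertex_submodule_def hY complex_vector_pair.linear_0[OF linear_right]
        complex_vector_pair.linear_subspace_kernel[OF h])
  then have ker: "{v. h v = 0} = {0} \<or> {v. h v = 0} = UNIV"
    using simple by (auto simp: simple_vertex_algebra_def hD D0)
  have "vertex_submodule Y (range h)"
    by (auto simp: vertex_submodule_def simp flip: hY
        intro!: complex_vector_pair.linear_subspace_image[OF h])
  moreover have "vertex_D vac Y ` range h \<subseteq> range h"
    by (auto simp flip: hD)
  ultimately have ran: "range h = {0} \<or> range h = UNIV"
    using simple by (auto simp: simple_vertex_algebra_def)
  have "h v = 0" for v
  proof (rule ccontr)
    assume "h v \<noteq> 0"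
    with ker ran have "{v. h v = 0} = {0}" "range h = UNIV" by auto
    then have "bij h"
      unfolding bij_def complex_vector_pair.linear_inj_iff_eq_0[OF h] by auto
    with c show False by (simp add: h_def[abs_def])
  qed
  then show ?thesis by (auto simp: h_def)
qed

lemma field_relations_independent:
  assumes simple: "simple_vertex_algebra vac Y" and dim: "countable_dimension TYPE('v)"
    and "finite S" "\<not> complex_vector.dependent S" "w \<in> field_relations S" "u \<in> S"
  shows "w u = 0"
  using assms(3-)
proof (induction S arbitrary: w u rule: finite_induct)
  case empty
  then show ?case by simp
next
  case (insert x S)
  let ?K = "field_relations (insert x S)"
  have fin: "finite (insert x S)" using insert.hyps by simp
  have S: "\<not> complex_vector.dependent S"
    using insert.prems(1) complex_vector.dependent_mono by blast
  have restrict: "w u = 0" if "w \<in> ?K" "w x = 0" "u \<in> S" for w u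
    using that insert.hyps insert.IH[OF S _ that(3), of w]
    by (simp add: field_relations_def complex_vector_pair.linear_0[OF linear_right])
  have uniq: "w u = w' u" if "w \<in> ?K" "w' \<in> ?K" "w x = w' x" "u \<in> S" for w w' u
    using restrict[OF field_relations_add[OF that(1) field_relations_scale[OF that(2), of "-1"]] _ that(4)]
      that(3) by simp
  show ?case
  proof (cases "w x = 0")
    case True
    with insert.prems restrict show ?thesis by blast
  next
    case False
    \<comment> \<open>The entries at \<open>x\<close> form a nonzero \<open>\<D>\<close>-stable
      submodule, so every vector occurs as one.\<close>
    define M where "M = (\<lambda>w. w x) ` ?K"
    have "(\<lambda>_. 0) \<in> ?K"
      by (simp add: field_relations_def complex_vector_pair.linear_0[OF linear_right])
    then have "0 \<in> M" by (auto simp: M_def intro!: image_eqI)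
    have "complex_vector.subspace M"
    proof (rule complex_vector.subspaceI)
      show "v + v' \<in> M" if "v \<in> M" "v' \<in> M" for v v'
        using that field_relations_add unfolding M_def by (fastforce intro: rev_image_eqI)
      show "c *\<^sub>C v \<in> M" if "v \<in> M" for c v
        using that field_relations_scale unfolding M_def by (fastforce intro: rev_image_eqI)
    qed fact
    moreover have "Y a n v \<in> M" if "v \<in> M" for a n v
      using that field_relations_mode[OF _ fin] unfolding M_def by (fastforce intro: rev_image_eqI)
    ultimately have "vertex_submodule Y M"
      by (simp add: vertex_submodule_def)
    moreover have "vertex_D vac Y ` M \<subseteq> M"
      using field_relations_vertex_D unfolding M_def by (fastforce intro: rev_image_eqI)
    moreover have "M \<noteq> {0}"
      using False insert.prems(2) by (auto simp: M_def)
    ultimately have "M = UNIV"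
      using simple by (auto simp: simple_vertex_algebra_def)
    then have "\<forall>v. \<exists>w\<in>?K. w x = v"
      unfolding M_def by (metis UNIV_I imageE)
    then obtain W where W: "\<And>v. W v \<in> ?K" "\<And>v. W v x = v" by metis
    \<comment> \<open>In each condition of Schur's lemma both sides are \<open>u\<close>-entries of
      relations with the same \<open>x\<close>-entry, so \<open>uniq\<close> identifies
      them.\<close>
    have "\<exists>c. \<forall>v. W v u = c *\<^sub>C v" if u: "u \<in> S" for u
    proof (rule schur_countable_dimension[OF simple dim])
      show "complex_linear (\<lambda>v. W v u)"
        by (rule complex_linearI; rule uniq[OF W(1) _ _ u])
          (simp_all add: W field_relations_add field_relations_scale)
      show "W (Y a n v) u = Y a n (W v u)" for a n v
        by (rule uniq[OF W(1) _ _ u]) (simp_all add: W field_relations_mode[OF _ fin])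
      show "W (vertex_D vac Y v) u = vertex_D vac Y (W v u)" for v
        by (rule uniq[OF W(1) _ _ u]) (simp_all add: W field_relations_vertex_D)
    qed
    then obtain c where c: "\<And>u v. u \<in> S \<Longrightarrow> W v u = c u *\<^sub>C v" by metis
    \<comment> \<open>Mode \<open>-1\<close> on the vacuum returns \<open>u\<close> itself, turning
      the relation among fields into one among vectors, with coefficient 1 at
      \<open>x\<close>.\<close>
    have "(\<Sum>u\<in>insert x S. Y u (-1) (W vac u)) = 0"
      using W(1)[of vac] by (simp add: field_relations_def)
    then have "x + (\<Sum>u\<in>S. c u *\<^sub>C u) = 0"
      using insert.hyps by (simp add: W c creation complex_linear_scale[OF linear_right])
    moreover have "(\<Sum>u\<in>S. (if u = x then 1 else c u) *\<^sub>C u) = (\<Sum>u\<in>S. c u *\<^sub>C u)"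
      using insert.hyps by (intro sum.cong) auto
    ultimately have "(\<Sum>u\<in>insert x S. (if u = x then 1 else c u) *\<^sub>C u) = 0"
      using insert.hyps by simp
    then have "complex_vector.dependent (insert x S)"
      unfolding complex_vector.dependent_finite[OF fin]
      by (intro exI[of _ "\<lambda>u. if u = x then 1 else c u"]) simp
    with insert.prems(1) show ?thesis by blast
  qed
qed

end

section \<open>Tensors as sums over independent left factors\<close>

text \<open>The difference of the two sides is a relator once \<open>a - (b + c)\<close> is written
  as \<open>a - b - c\<close>.\<close>

lemma pure_tensor_add_left: "(u + u') \<otimes>\<^sub>C v = u \<otimes>\<^sub>C v + u' \<otimes>\<^sub>C v"
  by transfer
    (unfold tensor_rel_def diff_diff_eq [symmetric],
      rule complex_vector.span_base, unfold tensor_relators_def, blast)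

lemma pure_tensor_add_right: "u \<otimes>\<^sub>C (v + v') = u \<otimes>\<^sub>C v + u \<otimes>\<^sub>C v'"
  by transfer
    (unfold tensor_rel_def diff_diff_eq [symmetric],
      rule complex_vector.span_base, unfold tensor_relators_def, blast)

lemma pure_tensor_scale_left: "(c *\<^sub>C u) \<otimes>\<^sub>C v = c *\<^sub>C (u \<otimes>\<^sub>C v)"
  by transfer
    (unfold tensor_rel_def, rule complex_vector.span_base, unfold tensor_relators_def, blast)

lemma pure_tensor_scale_right: "u \<otimes>\<^sub>C (c *\<^sub>C v) = c *\<^sub>C (u \<otimes>\<^sub>C v)"
  by transfer
    (unfold tensor_rel_def, rule complex_vector.span_base, unfold tensor_relators_def, blast)

lemma pure_tensor_0_right [simp]: "u \<otimes>\<^sub>C 0 = 0"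
  using pure_tensor_scale_right[of u 0 0] by simp

text \<open>A representative is built one pair at a time; the coefficient is absorbed into the left
  factor, so pure tensors suffice.\<close>

lemma tensor_induct [case_names zero add pure]:
  assumes "P 0" "\<And>s t. P s \<Longrightarrow> P t \<Longrightarrow> P (s + t)" "\<And>u v. P (u \<otimes>\<^sub>C v)"
  shows "P t"
proof -
  obtain f where t: "t = abs_tensor f"
    by (metis Quotient3_abs_rep[OF Quotient3_tensor])
  show ?thesis
    unfolding t
  proof (induction f rule: Poly_Mapping.update_induct)
    case const
    show ?case using assms(1) by (simp add: zero_tensor_def)
  next
    case (update f k c)
    obtain u v where k: "k = (u, v)" by (cases k)
    have "Poly_Mapping.update k c f = c *\<^sub>C Poly_Mapping.single (u, v) 1 + f"
      using update.hyps
      by (intro poly_mapping_eqI)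
        (auto simp: k lookup_add lookup_update lookup_single when_def in_keys_iff)
    then have "abs_tensor (Poly_Mapping.update k c f) = c *\<^sub>C (u \<otimes>\<^sub>C v) + abs_tensor f"
      by (simp add: pure_tensor.abs_eq scaleC_tensor.abs_eq plus_tensor.abs_eq)
    also have "\<dots> = (c *\<^sub>C u) \<otimes>\<^sub>C v + abs_tensor f"
      by (simp add: pure_tensor_scale_left)
    finally show ?case by (simp add: assms(2,3) update)
  qed
qed

lemma tensor_eq_sum_basis:
  assumes B: "complex_vector.span B = UNIV"
  shows "\<exists>S w. finite S \<and> S \<subseteq> B \<and> t = (\<Sum>u\<in>S. u \<otimes>\<^sub>C w u)"
proof (induction t rule: tensor_induct)
  case zero
  show ?case by (intro exI[of _ "{}"]) simp
next
  case (add s t)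
  then obtain S w S' w' where *: "finite S" "S \<subseteq> B" "s = (\<Sum>u\<in>S. u \<otimes>\<^sub>C w u)"
    "finite S'" "S' \<subseteq> B" "t = (\<Sum>u\<in>S'. u \<otimes>\<^sub>C w' u)"
    by blast
  \<comment> \<open>Both sums are padded by zero right factors to a common index set, where right
    factors add.\<close>
  have "s = (\<Sum>u\<in>S \<union> S'. u \<otimes>\<^sub>C (if u \<in> S then w u else 0))"
    unfolding *(3) using * by (intro sum.mono_neutral_cong_left) auto
  moreover have "t = (\<Sum>u\<in>S \<union> S'. u \<otimes>\<^sub>C (if u \<in> S' then w' u else 0))"
    unfolding *(6) using * by (intro sum.mono_neutral_cong_left) auto
  ultimately have "s + t = (\<Sum>u\<in>S \<union> S'. u \<otimes>\<^sub>C
      ((if u \<in> S then w u else 0) + (if u \<in> S' then w' u else 0)))"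
    by (simp only: pure_tensor_add_right sum.distrib)
  with * show ?case
    by (intro exI[of _ "S \<union> S'"] exI[of _ "\<lambda>u. (if u \<in> S then w u else 0) + (if u \<in> S' then w' u else 0)"]) auto
next
  case (pure u v)
  have "u \<in> complex_vector.span B" by (simp add: B)
  then obtain S a where S: "finite S" "S \<subseteq> B" "u = (\<Sum>b\<in>S. a b *\<^sub>C b)"
    unfolding complex_vector.span_explicit by auto
  have lin: "complex_linear (\<lambda>u. u \<otimes>\<^sub>C v)"
    by (rule complex_linearI) (simp_all add: pure_tensor_add_left pure_tensor_scale_left)
  have "u \<otimes>\<^sub>C v = (\<Sum>b\<in>S. b \<otimes>\<^sub>C (a b *\<^sub>C v))"
    unfolding S(3)
    by (simp add: complex_vector_pair.linear_sum[OF lin] pure_tensor_scale_left pure_tensor_scale_right)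
  with S(1,2) show ?case by (intro exI[of _ S] exI[of _ "\<lambda>b. a b *\<^sub>C v"] conjI)
qed

section \<open>Injectivity of \<open>pi2\<close>\<close>

lemma (in vertex_algebra) simple_imp_pi2_injective:
  assumes simple: "simple_vertex_algebra vac Y" and dim: "countable_dimension TYPE('v)"
  shows "pi2_injective Y"
  unfolding pi2_injective_def complex_vector_pair.linear_inj_iff_eq_0[OF complex_linear_pi2]
proof (intro allI impI)
  fix t assume t: "pi2 Y t = 0"
  obtain B :: "'v set" where B: "\<not> complex_vector.dependent B" "complex_vector.span B = UNIV"
    using dim by (auto simp: countable_dimension_def)
  obtain S w where S: "finite S" "S \<subseteq> B" "t = (\<Sum>u\<in>S. u \<otimes>\<^sub>C w u)"
    using tensor_eq_sum_basis[OF B(2), of t] by blast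
  have "(\<Sum>u\<in>S. vertex_series Y u (w u)) = 0"
    using t by (simp add: S(3) complex_vector_pair.linear_sum[OF complex_linear_pi2] pi2_pure)
  then have "(\<Sum>u\<in>S. fls_nth (vertex_series Y u (w u)) k) = 0" for k
    by (metis fls_nth_sum fls_zero_nth)
  \<comment> \<open>The coefficient of exponent \<open>-n-1\<close> is mode
    \<open>n\<close>.\<close>
  from this[of "-n-1" for n] have "w \<in> field_relations S"
    by (simp add: field_relations_def)
  moreover have "\<not> complex_vector.dependent S"
    using B(1) S(2) complex_vector.dependent_mono by blast
  ultimately have "w u = 0" if "u \<in> S" for u
    using field_relations_independent[OF simple dim S(1)] that by blast
  then show "t = 0" by (simp add: S(3))
qed

theorem proposition4p3:
  fixes vac :: "'v::complex_vector" and Y :: "'v \<Rightarrow> int \<Rightarrow> 'v \<Rightarrow> 'v"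
  assumes "vertex_algebra vac Y"
    and "countable_dimension TYPE('v)"
  shows "(simple_vertex_algebra vac Y \<longrightarrow> pi2_injective Y) \<and>
         (irreducible_vertex_algebra Y \<longrightarrow> pi2_injective Y)"
proof -
  \<comment> \<open>Irreducibility constrains all submodules, in particular the
    \<open>\<D>\<close>-stable ones.\<close>
  have "simple_vertex_algebra vac Y" if "irreducible_vertex_algebra Y"
    using that by (simp add: irreducible_vertex_algebra_def simple_vertex_algebra_def)
  then show ?thesis
    using vertex_algebra.simple_imp_pi2_injective[OF assms(1) _ assms(2)] by blast
qed

end
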